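(* For an increasing function $f$ on $[0,\infty)$ let $c_n(f)=\sup_{X\in G(0,0)}E f(Y_n)$ and $c(f)=\lim_{n}c_n(f)$, where $G(0,0)$ and the predictable sequence $(Y_n)$ associated with $X$ are defined in the context. Then: (a) For functions $f(x)=e^{\lambda x}$, $\lambda>0$: $c(f)=\frac{1}{1-\lambda}$ if $0<\lambda<1$, and $c(f)=\infty$ if $\lambda\ge 1$. (b) For functions $f(x)=x^m$, $m\ge 1$: $c(f)\le m^m$. (c) For any increasing convex function $f(x)$, $x\ge 0$, with concave derivative $f'(x)$, $c(f)\le B<\infty$, where $B$ is the unique solution of the equation $$B=f(0)+f'(f^{-1}(B)).$$
   Context: Let $X=(X_n)_{n\ge 0}$ be a submartingale on a filtered probability space $(\Omega,\mathcal F,(\mathcal F_n)_{n\ge 0},P)$ with $0\le X_n\le 1$ for all $n$. Its Doob decomposition is $X_n=Y_n+M_n$, $n=0,1,\dots$, where $M=(M_n)$ is a martingale and $Y=(Y_n)$ is the predictable nondecreasing random sequence $Y_n=\sum_{k=1}^{n}E(X_k-X_{k-1}\mid\mathcal F_{k-1})$ for $n\ge1$, $Y_0=0$. $G(0,0)$ denotes the class of all such submartingales with $0\le X_n\le 1$ and $X_0=Y_0=0$. In $c_n(f)$, $Y_n$ is the predictable part of $X$ at time $n$. $f^{-1}$ denotes the inverse function of $f$.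
   Formalization: In (c), B is the unique solution with B > f(0): if f'(0)=0 then B=f(0) also solves the equation (for f(x)=x^2 the solutions are 0 and 4), so uniqueness fails as literally stated; f is taken strictly increasing so that its inverse exists. *)

theory Defs
  imports "HOL-Probability.Probability"
begin

definition filtered_prob_space :: "'w measure \<Rightarrow> (nat \<Rightarrow> 'w measure) \<Rightarrow> bool" where
  "filtered_prob_space M F \<longleftrightarrow>
     prob_space M \<and> filtration (space M) F \<and> (\<forall>n. subalgebra M (F n))"

definition submartingale ::
  "'w measure \<Rightarrow> (nat \<Rightarrow> 'w measure) \<Rightarrow> (nat \<Rightarrow> 'w \<Rightarrow> real) \<Rightarrow> bool" where
  "submartingale M F X \<longleftrightarrow>
     (\<forall>n. X n \<in> borel_measurable (F n)) \<and> (\<forall>n. integrable M (X n)) \<and>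
     (\<forall>n. AE \<omega> in M. X n \<omega> \<le> real_cond_exp M (F n) (X (Suc n)) \<omega>)"

text \<open>The nondecreasing predictable sequence $Y$ of the Doob decomposition $X = Y + M$.\<close>

definition predictable_part ::
  "'w measure \<Rightarrow> (nat \<Rightarrow> 'w measure) \<Rightarrow> (nat \<Rightarrow> 'w \<Rightarrow> real) \<Rightarrow> nat \<Rightarrow> 'w \<Rightarrow> real" where
  "predictable_part M F X n \<omega> =
     (\<Sum>k = 1..n. real_cond_exp M (F (k - 1)) (\<lambda>\<omega>'. X k \<omega>' - X (k - 1) \<omega>') \<omega>)"

text \<open>The condition $Y_0 = 0$ is automatic, the sum above being empty for \<open>n = 0\<close>.\<close>

definition G00 :: "('w measure \<times> (nat \<Rightarrow> 'w measure) \<times> (nat \<Rightarrow> 'w \<Rightarrow> real)) set" where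
  "G00 = {(M, F, X). filtered_prob_space M F \<and> submartingale M F X \<and>
            (\<forall>n. \<forall>\<omega>\<in>space M. 0 \<le> X n \<omega> \<and> X n \<omega> \<le> 1) \<and> (\<forall>\<omega>\<in>space M. X 0 \<omega> = 0)}"

text \<open>
  The supremum ranges over all filtered probability spaces whose sample space is a subset of the
  type \<open>'w\<close>; the type argument records this choice.

  The functions \<open>f\<close> of interest are given on $[0,\infty)$ only, whereas the version of $Y_n$ picked
  by \<^const>\<open>real_cond_exp\<close> is nonnegative merely almost surely. Taking \<open>max 0\<close> changes
  $Y_n$ on a null set only, and makes the expectation independent of the values of \<open>f\<close> on the
  negative reals.
\<close>

definition c_n :: "'w itself \<Rightarrow> (real \<Rightarrow> real) \<Rightarrow> nat \<Rightarrow> ereal" where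
  "c_n T f n =
     (SUP (M, F, X) \<in> (G00 :: ('w measure \<times> (nat \<Rightarrow> 'w measure) \<times> (nat \<Rightarrow> 'w \<Rightarrow> real)) set).
        ereal (\<integral>\<omega>. f (max 0 (predictable_part M F X n \<omega>)) \<partial>M))"

definition c_lim :: "'w itself \<Rightarrow> (real \<Rightarrow> real) \<Rightarrow> ereal" where
  "c_lim T f = lim (c_n T f)"

text \<open>
  The equation $B = f(0) + f'(f^{-1}(B))$, with the inverse of \<open>f\<close> as a function on $[0,\infty)$.
  The restriction \<open>f 0 < B\<close> holds for every solution when $f'(0) > 0$. When $f'(0) = 0$ it
  excludes the degenerate solution \<open>B = f 0\<close>: for $f(x) = x^2$ the equation is solved by
  $0$ and by $4$, and the bound in question is $4$.
\<close>

definition solves_B_equation :: "(real \<Rightarrow> real) \<Rightarrow> (real \<Rightarrow> real) \<Rightarrow> real \<Rightarrow> bool" where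
  "solves_B_equation f f' B \<longleftrightarrow> f 0 < B \<and> B = f 0 + f' (inv_into {0..} f B)"

end

theory Submission
  imports Defs
begin

text \<open>
  Write \<open>D\<^sub>k = E(X\<^sub>k\<^sub>+\<^sub>1 - X\<^sub>k | F\<^sub>k)\<close> for the increments of \<open>Y\<close>. Since \<open>0 \<le> X \<le> 1\<close>, the remaining
  growth satisfies \<open>E(Y\<^sub>N - Y\<^sub>k | F\<^sub>k) = E(X\<^sub>N - X\<^sub>k | F\<^sub>k) \<le> 1\<close>. For convex \<open>f\<close> with derivative \<open>\<phi>\<close>,
  bounding \<open>f(Y\<^sub>N) - f(0)\<close> by \<open>\<Sum> \<phi>(Y\<^sub>k\<^sub>+\<^sub>1) D\<^sub>k\<close> and summing by parts yields the basic inequality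
  \<open>E f(Y\<^sub>N) \<le> f(0) + E \<phi>(Y\<^sub>N)\<close>. It gives every upper bound as soon as \<open>\<phi> \<le> c + \<kappa> f\<close> with \<open>\<kappa> < 1\<close>: for the
  exponential \<open>\<phi> = \<lambda> f\<close>; for \<open>x\<^sup>m\<close> use the tangent of \<open>f\<close> with base point \<open>m\<close>; in case (c),
  \<open>\<phi>\<close> is a concave function of \<open>f\<close>, and its tangent at \<open>B\<close> has slope less than \<open>1\<close>. The lower bound in (a)
  comes from a process that waits at \<open>0\<close> and jumps to \<open>1\<close> at a geometric time.
\<close>

section \<open>The predictable part of a submartingale with values in the unit interval\<close>

text \<open>Reconciles the range \<open>1..n\<close> in \<open>predictable_part\<close> with
  \<open>k<n\<close>; clipping does nothing to increments already in the unit interval.\<close>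

lemma sum_eq_sum_clip:
  fixes d :: "nat \<Rightarrow> real"
  assumes "\<And>k. 0 \<le> d k \<and> d k \<le> 1"
  shows "(\<Sum>k = 1..n. d (k - 1)) = (\<Sum>k<n. max 0 (min 1 (d k)))"
proof (rule sum.reindex_bij_witness[of _ Suc "\<lambda>k. k - 1"])
  show "max 0 (min 1 (d (k - 1))) = d (k - 1)" for k
    using assms[of "k - 1"] by linarith
qed auto

text \<open>Composing with \<open>max 0\<close> gives a function monotone on the whole line, and
  monotone functions are Borel.\<close>

lemma mono_comp_max_measurable:
  fixes g :: "real \<Rightarrow> real"
  assumes "mono_on {0..} g"
  shows "(\<lambda>x. g (max 0 x)) \<in> borel_measurable borel"
  by (rule borel_measurable_mono) (auto intro!: monoI mono_onD[OF assms])

text \<open>Abel summation arranged so that each increment of the weight meets the remaining growth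
  \<open>y N - y k\<close>, the quantity whose expectation is controlled.\<close>

lemma weighted_increments_by_parts:
  fixes a y :: "nat \<Rightarrow> real"
  shows "(\<Sum>j<N. a (Suc j) * (y (Suc j) - y j)) =
         a 0 * (y N - y 0) + (\<Sum>k<N. (a (Suc k) - a k) * (y N - y k))"
proof (induction N)
  case (Suc N)
  have "(\<Sum>k<Suc N. (a (Suc k) - a k) * (y (Suc N) - y k))
      = (\<Sum>k<Suc N. (a (Suc k) - a k) * (y N - y k) + (a (Suc k) - a k) * (y (Suc N) - y N))"
    by (intro sum.cong) (auto simp: algebra_simps)
  also have "\<dots> = (\<Sum>k<N. (a (Suc k) - a k) * (y N - y k))
      + (\<Sum>k<Suc N. a (Suc k) - a k) * (y (Suc N) - y N)"
    by (simp only: sum.distrib sum_distrib_right) simp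
  also have "(\<Sum>k<Suc N. a (Suc k) - a k) = a (Suc N) - a 0"
    by (rule sum_lessThan_telescope)
  finally show ?case
    using Suc by (simp add: algebra_simps)
qed simp

locale G00_member =
  fixes M :: "'w measure" and F :: "nat \<Rightarrow> 'w measure" and X :: "nat \<Rightarrow> 'w \<Rightarrow> real"
  assumes mem: "(M, F, X) \<in> G00"
begin

sublocale prob_space M
  using mem by (simp add: G00_def filtered_prob_space_def)

lemma filtration: "filtration (space M) F" and subalgebra: "subalgebra M (F n)"
  and X_measurable_F: "X n \<in> borel_measurable (F n)" and integrable_X: "integrable M (X n)"
  and submart: "AE \<omega> in M. X n \<omega> \<le> real_cond_exp M (F n) (X (Suc n)) \<omega>"
  using mem by (auto simp: G00_def filtered_prob_space_def submartingale_def)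

lemma X_bounds: "\<omega> \<in> space M \<Longrightarrow> 0 \<le> X n \<omega> \<and> X n \<omega> \<le> 1"
  using mem by (auto simp: G00_def)

lemma X_measurable [measurable]: "X n \<in> borel_measurable M"
  using integrable_X by (rule borel_measurable_integrable)

lemma sigma_finite_subalgebra_F: "sigma_finite_subalgebra M (F n)"
  by (intro sigma_finite_subalgebra.intro subalgebra finite_measure_subalgebra_is_sigma_finite
      finite_measure_subalgebra.intro finite_measure_subalgebra_axioms.intro) unfold_locales

lemma measurable_F_mono: "k \<le> j \<Longrightarrow> g \<in> borel_measurable (F k) \<Longrightarrow> g \<in> borel_measurable (F j)"
  using filtration.sets_F_mono[OF filtration, of k j] filtration.space_F[OF filtration]
  by (auto simp: measurable_def)

lemma measurable_F_M: "g \<in> borel_measurable (F k) \<Longrightarrow> g \<in> borel_measurable M"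
  using measurable_from_subalg[OF subalgebra] .

abbreviation raw_drift :: "nat \<Rightarrow> 'w \<Rightarrow> real" where
  "raw_drift n \<equiv> real_cond_exp M (F n) (\<lambda>\<omega>. X (Suc n) \<omega> - X n \<omega>)"

text \<open>Clipping changes the conditional expectation on a null set only, and turns almost sure
  bounds into bounds at every point.\<close>

definition drift :: "nat \<Rightarrow> 'w \<Rightarrow> real" where
  "drift n \<omega> = max 0 (min 1 (raw_drift n \<omega>))"

definition Y :: "nat \<Rightarrow> 'w \<Rightarrow> real" where
  "Y n \<omega> = (\<Sum>k<n. drift k \<omega>)"

text \<open>The lower bound is the submartingale inequality; the upper one holds since increments of
  a process in the unit interval are at most \<open>1\<close>.\<close>

lemma raw_drift_bounds: "AE \<omega> in M. 0 \<le> raw_drift n \<omega> \<and> raw_drift n \<omega> \<le> 1"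
proof -
  interpret S: sigma_finite_subalgebra M "F n" by (rule sigma_finite_subalgebra_F)
  have int: "integrable M (\<lambda>\<omega>. X (Suc n) \<omega> - X n \<omega>)"
    by (intro Bochner_Integration.integrable_diff integrable_X)
  have "AE \<omega> in M. raw_drift n \<omega> \<le> 1"
  proof (rule S.real_cond_exp_le_c[OF int], rule AE_I2)
    fix \<omega> assume "\<omega> \<in> space M"
    with X_bounds[of \<omega> n] X_bounds[of \<omega> "Suc n"] show "X (Suc n) \<omega> - X n \<omega> \<le> 1" by linarith
  qed
  moreover have "AE \<omega> in M. raw_drift n \<omega>
      = real_cond_exp M (F n) (X (Suc n)) \<omega> - real_cond_exp M (F n) (X n) \<omega>"
    by (intro S.real_cond_exp_diff integrable_X)
  moreover have "AE \<omega> in M. real_cond_exp M (F n) (X n) \<omega> = X n \<omega>"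
    by (intro S.real_cond_exp_F_meas integrable_X X_measurable_F)
  ultimately show ?thesis
    using submart[of n] by eventually_elim simp
qed

lemma predictable_part_eq_Y: "AE \<omega> in M. max 0 (predictable_part M F X n \<omega>) = Y n \<omega>"
proof -
  have "AE \<omega> in M. \<forall>k. 0 \<le> raw_drift k \<omega> \<and> raw_drift k \<omega> \<le> 1"
    using raw_drift_bounds by (simp add: AE_all_countable)
  then show ?thesis
  proof eventually_elim
    case (elim \<omega>)
    have "predictable_part M F X n \<omega> = (\<Sum>k = 1..n. raw_drift (k - 1) \<omega>)"
      unfolding predictable_part_def by (intro sum.cong) auto
    also have "\<dots> = Y n \<omega>"
      unfolding Y_def drift_def using elim by (intro sum_eq_sum_clip) auto
    finally show ?case
      by (simp add: Y_def drift_def sum_nonneg)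
  qed
qed

lemma drift_bounds: "0 \<le> drift n \<omega>" "drift n \<omega> \<le> 1"
  by (auto simp: drift_def)

lemma Y_0 [simp]: "Y 0 \<omega> = 0"
  by (simp add: Y_def)

lemma Y_Suc: "Y (Suc n) \<omega> = Y n \<omega> + drift n \<omega>"
  by (simp add: Y_def)

lemma Y_nonneg: "0 \<le> Y n \<omega>"
  by (simp add: Y_def drift_bounds sum_nonneg)

lemma Y_le: "Y n \<omega> \<le> n"
  using sum_bounded_above[of "{..<n}" "\<lambda>k. drift k \<omega>" 1] by (simp add: Y_def drift_bounds)

lemma drift_measurable_F: "drift n \<in> borel_measurable (F n)"
  unfolding drift_def by measurable

lemma Y_Suc_measurable_F: "Y (Suc n) \<in> borel_measurable (F n)"
  unfolding Y_def
  by (intro borel_measurable_sum) (auto intro: measurable_F_mono[OF _ drift_measurable_F])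

lemma Y_measurable_F: "Y n \<in> borel_measurable (F n)"
proof (cases n)
  case 0
  then show ?thesis
    by (simp add: Y_def[abs_def])
next
  case (Suc m)
  then show ?thesis
    using measurable_F_mono[of m n, OF _ Y_Suc_measurable_F] by simp
qed

lemma Y_measurable [measurable]: "Y n \<in> borel_measurable M"
  using Y_measurable_F by (rule measurable_F_M)

lemma integrable_bounded:
  fixes g :: "'w \<Rightarrow> real"
  assumes "g \<in> borel_measurable M" "\<And>\<omega>. \<omega> \<in> space M \<Longrightarrow> \<bar>g \<omega>\<bar> \<le> C"
  shows "integrable M g"
  using assms by (intro integrable_const_bound[of _ C]) auto

text \<open>Keeping \<open>k\<close> apart from \<open>n\<close> covers both \<open>Y k\<close> and,
  by predictability, \<open>Y (Suc k)\<close> at time \<open>k\<close>.\<close>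

lemma comp_Y_measurable_F:
  fixes g :: "real \<Rightarrow> real"
  assumes "mono_on {0..} g" "Y n \<in> borel_measurable (F k)"
  shows "(\<lambda>\<omega>. g (Y n \<omega>)) \<in> borel_measurable (F k)"
  using measurable_compose[OF assms(2) mono_comp_max_measurable[OF assms(1)]]
  by (simp add: Y_nonneg max_absorb2)

lemma comp_Y_bounds:
  fixes g :: "real \<Rightarrow> real"
  assumes "mono_on {0..} g"
  shows "g 0 \<le> g (Y n \<omega>)" "g (Y n \<omega>) \<le> g n"
  by (intro mono_onD[OF assms]; simp add: Y_nonneg Y_le)+

lemma integrable_comp_Y:
  fixes g :: "real \<Rightarrow> real"
  assumes "mono_on {0..} g"
  shows "integrable M (\<lambda>\<omega>. g (Y n \<omega>))"
proof (rule integrable_bounded)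
  show "(\<lambda>\<omega>. g (Y n \<omega>)) \<in> borel_measurable M"
    by (rule measurable_F_M[OF comp_Y_measurable_F[OF assms Y_measurable_F]])
  show "\<bar>g (Y n \<omega>)\<bar> \<le> \<bar>g 0\<bar> + \<bar>g n\<bar>" for \<omega>
    using comp_Y_bounds[OF assms, of n \<omega>] by linarith
qed

lemma expectation_predictable_part:
  fixes g :: "real \<Rightarrow> real"
  assumes "mono_on {0..} g"
  shows "(\<integral>\<omega>. g (max 0 (predictable_part M F X n \<omega>)) \<partial>M) = (\<integral>\<omega>. g (Y n \<omega>) \<partial>M)"
proof (rule integral_cong_AE)
  have "predictable_part M F X n \<in> borel_measurable M"
    unfolding predictable_part_def[abs_def] by measurable
  from measurable_compose[OF this mono_comp_max_measurable[OF assms]]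
  show "(\<lambda>\<omega>. g (max 0 (predictable_part M F X n \<omega>))) \<in> borel_measurable M" .
  show "(\<lambda>\<omega>. g (Y n \<omega>)) \<in> borel_measurable M"
    using integrable_comp_Y[OF assms] by (rule borel_measurable_integrable)
  show "AE \<omega> in M. g (max 0 (predictable_part M F X n \<omega>)) = g (Y n \<omega>)"
    using predictable_part_eq_Y[of n] by eventually_elim simp
qed

text \<open>Integrated against a weight known at time \<open>k\<close>, \<open>drift j\<close> and
  the increment of \<open>X\<close> agree for all \<open>j \<ge> k\<close>. Telescoping leaves the
  integral of \<open>Z * (X N - X k)\<close>, at most that of \<open>Z\<close>.\<close>

lemma expectation_increment_le:
  assumes Z: "Z \<in> borel_measurable (F k)" and Z0: "\<And>\<omega>. 0 \<le> Z \<omega>" and ZC: "\<And>\<omega>. Z \<omega> \<le> C"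
    and "k \<le> N"
  shows "(\<integral>\<omega>. Z \<omega> * (Y N \<omega> - Y k \<omega>) \<partial>M) \<le> (\<integral>\<omega>. Z \<omega> \<partial>M)"
proof -
  have [measurable]: "Z \<in> borel_measurable M"
    using Z by (rule measurable_F_M)
  have [measurable]: "drift j \<in> borel_measurable M" for j
    using drift_measurable_F by (rule measurable_F_M)
  have ZX: "integrable M (\<lambda>\<omega>. Z \<omega> * X j \<omega>)" for j
  proof (rule integrable_bounded)
    show "\<bar>Z \<omega> * X j \<omega>\<bar> \<le> C * 1" if "\<omega> \<in> space M" for \<omega>
      unfolding abs_mult using X_bounds[OF that, of j] Z0[of \<omega>] ZC[of \<omega>]
      by (intro mult_mono) auto
  qed measurable
  have ZD: "integrable M (\<lambda>\<omega>. Z \<omega> * drift j \<omega>)" for j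
  proof (rule integrable_bounded)
    show "\<bar>Z \<omega> * drift j \<omega>\<bar> \<le> C * 1" for \<omega>
      unfolding abs_mult using drift_bounds[of j \<omega>] Z0[of \<omega>] ZC[of \<omega>]
      by (intro mult_mono) auto
  qed measurable
  have drift_eq: "(\<integral>\<omega>. Z \<omega> * drift j \<omega> \<partial>M) = (\<integral>\<omega>. Z \<omega> * X (Suc j) \<omega> \<partial>M) - (\<integral>\<omega>. Z \<omega> * X j \<omega> \<partial>M)"
    if "k \<le> j" for j
  proof -
    interpret S: sigma_finite_subalgebra M "F j" by (rule sigma_finite_subalgebra_F)
    have "(\<integral>\<omega>. Z \<omega> * drift j \<omega> \<partial>M) = (\<integral>\<omega>. Z \<omega> * raw_drift j \<omega> \<partial>M)"
    proof (rule integral_cong_AE)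
      show "AE \<omega> in M. Z \<omega> * drift j \<omega> = Z \<omega> * raw_drift j \<omega>"
        using raw_drift_bounds[of j] by eventually_elim (simp add: drift_def)
    qed measurable
    also have "\<dots> = (\<integral>\<omega>. Z \<omega> * (X (Suc j) \<omega> - X j \<omega>) \<partial>M)"
      using Z ZX[of "Suc j"] ZX[of j] that
      by (intro S.real_cond_exp_intg)
         (auto simp: right_diff_distrib intro: measurable_F_mono[OF that])
    finally show ?thesis
      using ZX[of "Suc j"] ZX[of j] by (simp add: right_diff_distrib)
  qed
  \<comment> \<open>Integrability is carried through the induction because each step splits the
    integral of a sum.\<close>
  have "(\<integral>\<omega>. Z \<omega> * (Y N \<omega> - Y k \<omega>) \<partial>M) = (\<integral>\<omega>. Z \<omega> * X N \<omega> \<partial>M) - (\<integral>\<omega>. Z \<omega> * X k \<omega> \<partial>M)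
      \<and> integrable M (\<lambda>\<omega>. Z \<omega> * (Y N \<omega> - Y k \<omega>))"
    using \<open>k \<le> N\<close>
  proof (induction N rule: dec_induct)
    case (step n)
    have eq: "(\<lambda>\<omega>. Z \<omega> * (Y (Suc n) \<omega> - Y k \<omega>))
        = (\<lambda>\<omega>. Z \<omega> * (Y n \<omega> - Y k \<omega>) + Z \<omega> * drift n \<omega>)"
      by (simp add: Y_Suc algebra_simps)
    show ?case
      unfolding eq using step ZD[of n] drift_eq[of n] by simp
  qed simp
  then have "(\<integral>\<omega>. Z \<omega> * (Y N \<omega> - Y k \<omega>) \<partial>M) = (\<integral>\<omega>. Z \<omega> * X N \<omega> \<partial>M) - (\<integral>\<omega>. Z \<omega> * X k \<omega> \<partial>M)"
    by simp
  also have "\<dots> \<le> (\<integral>\<omega>. Z \<omega> \<partial>M)"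
  proof -
    have "0 \<le> (\<integral>\<omega>. Z \<omega> * X k \<omega> \<partial>M)"
      using X_bounds Z0 by (intro integral_nonneg_AE AE_I2) auto
    moreover have "(\<integral>\<omega>. Z \<omega> * X N \<omega> \<partial>M) \<le> (\<integral>\<omega>. Z \<omega> \<partial>M)"
    proof (rule integral_mono[OF ZX])
      show "integrable M Z"
        using Z0 ZC by (intro integrable_bounded[where C = C]) (auto simp: abs_of_nonneg)
      show "Z \<omega> * X N \<omega> \<le> Z \<omega>" if "\<omega> \<in> space M" for \<omega>
        using X_bounds[OF that, of N] Z0[of \<omega>] by (simp add: mult_left_le)
    qed
    ultimately show ?thesis by linarith
  qed
  finally show ?thesis .
qed

text \<open>
  Predictability is what makes this work: the weights \<open>\<phi> (Y\<^sub>k\<^sub>+\<^sub>1) - \<phi> (Y\<^sub>k)\<close> left by summation by parts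
  are measurable at time \<open>k\<close>.
\<close>

lemma expectation_le_gradient:
  assumes f: "mono_on {0..} f" and \<phi>: "mono_on {0..} \<phi>" and \<phi>0: "0 \<le> \<phi> 0"
    and grad: "\<And>u v. 0 \<le> u \<Longrightarrow> u \<le> v \<Longrightarrow> f v - f u \<le> \<phi> v * (v - u)"
  shows "(\<integral>\<omega>. f (Y N \<omega>) \<partial>M) \<le> f 0 + (\<integral>\<omega>. \<phi> (Y N \<omega>) \<partial>M)"
proof -
  define Z where "Z k \<omega> = \<phi> (Y (Suc k) \<omega>) - \<phi> (Y k \<omega>)" for k \<omega>
  have Z0: "0 \<le> Z k \<omega>" for k \<omega>
    unfolding Z_def using mono_onD[OF \<phi>, of "Y k \<omega>" "Y (Suc k) \<omega>"]
    by (simp add: Y_nonneg) (simp add: Y_Suc drift_bounds)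
  have ZC: "Z k \<omega> \<le> \<phi> (Suc k) - \<phi> 0" for k \<omega>
    unfolding Z_def
    using comp_Y_bounds(2)[OF \<phi>, of "Suc k" \<omega>] comp_Y_bounds(1)[OF \<phi>, of k \<omega>] by linarith
  have Z_meas: "Z k \<in> borel_measurable (F k)" for k
    unfolding Z_def[abs_def]
    by (intro borel_measurable_diff comp_Y_measurable_F[OF \<phi> Y_Suc_measurable_F]
        comp_Y_measurable_F[OF \<phi> Y_measurable_F])
  have Z_meas' [measurable]: "Z k \<in> borel_measurable M" for k
    using Z_meas by (rule measurable_F_M)
  have ZY: "integrable M (\<lambda>\<omega>. Z k \<omega> * (Y N \<omega> - Y k \<omega>))" if "k < N" for k
  proof (rule integrable_bounded)
    show "\<bar>Z k \<omega> * (Y N \<omega> - Y k \<omega>)\<bar> \<le> (\<phi> (Suc k) - \<phi> 0) * (real N + real k)" for \<omega>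
      unfolding abs_mult using Z0[of k \<omega>] ZC[of k \<omega>] Y_nonneg[of N \<omega>] Y_nonneg[of k \<omega>]
        Y_le[of N \<omega>] Y_le[of k \<omega>]
      by (intro mult_mono) auto
  qed measurable
  have intZ: "integrable M (Z k)" for k
    unfolding Z_def[abs_def] by (intro Bochner_Integration.integrable_diff integrable_comp_Y \<phi>)
  have intY: "integrable M (Y N)"
    using integrable_comp_Y[of "\<lambda>x. x"] by (simp add: mono_on_def)
  have pw: "f (Y N \<omega>) - f 0 \<le> \<phi> 0 * Y N \<omega> + (\<Sum>k<N. Z k \<omega> * (Y N \<omega> - Y k \<omega>))" for \<omega>
  proof -
    have "f (Y N \<omega>) - f 0 = (\<Sum>j<N. f (Y (Suc j) \<omega>) - f (Y j \<omega>))"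
      using sum_lessThan_telescope[of "\<lambda>j. f (Y j \<omega>)" N] by simp
    \<comment> \<open>Slopes are taken at the right endpoint \<open>Y (Suc j)\<close>, where
      \<open>grad\<close> makes them dominate the chord.\<close>
    also have "\<dots> \<le> (\<Sum>j<N. \<phi> (Y (Suc j) \<omega>) * (Y (Suc j) \<omega> - Y j \<omega>))"
      by (intro sum_mono grad) (simp_all add: Y_nonneg Y_Suc drift_bounds)
    also have "\<dots> = \<phi> 0 * Y N \<omega> + (\<Sum>k<N. Z k \<omega> * (Y N \<omega> - Y k \<omega>))"
      using weighted_increments_by_parts[of "\<lambda>j. \<phi> (Y j \<omega>)" "\<lambda>j. Y j \<omega>" N] by (simp add: Z_def)
    finally show ?thesis .
  qed
  have "(\<integral>\<omega>. f (Y N \<omega>) \<partial>M) - f 0 = (\<integral>\<omega>. f (Y N \<omega>) - f 0 \<partial>M)"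
    using integrable_comp_Y[OF f] by (simp add: prob_space)
  also have "\<dots> \<le> (\<integral>\<omega>. \<phi> 0 * Y N \<omega> + (\<Sum>k<N. Z k \<omega> * (Y N \<omega> - Y k \<omega>)) \<partial>M)"
  proof (rule integral_mono[OF _ _ pw])
    show "integrable M (\<lambda>\<omega>. f (Y N \<omega>) - f 0)"
      using integrable_comp_Y[OF f] by simp
    show "integrable M (\<lambda>\<omega>. \<phi> 0 * Y N \<omega> + (\<Sum>k<N. Z k \<omega> * (Y N \<omega> - Y k \<omega>)))"
      using intY ZY by (intro Bochner_Integration.integrable_add integrable_mult_right
          Bochner_Integration.integrable_sum) auto
  qed
  also have "\<dots> = \<phi> 0 * (\<integral>\<omega>. Y N \<omega> \<partial>M) + (\<Sum>k<N. \<integral>\<omega>. Z k \<omega> * (Y N \<omega> - Y k \<omega>) \<partial>M)"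
    using intY ZY by (subst Bochner_Integration.integral_add) auto
  also have "\<dots> \<le> \<phi> 0 * 1 + (\<Sum>k<N. \<integral>\<omega>. Z k \<omega> \<partial>M)"
  proof (intro add_mono mult_left_mono sum_mono \<phi>0)
    \<comment> \<open>The constant weight \<open>1\<close> from time \<open>0\<close> on, where
      \<open>Y 0 = 0\<close>.\<close>
    show "(\<integral>\<omega>. Y N \<omega> \<partial>M) \<le> 1"
      using expectation_increment_le[of "\<lambda>_. 1" 0 1 N] by (simp add: prob_space)
    show "(\<integral>\<omega>. Z k \<omega> * (Y N \<omega> - Y k \<omega>) \<partial>M) \<le> (\<integral>\<omega>. Z k \<omega> \<partial>M)" if "k \<in> {..<N}" for k
      using that by (intro expectation_increment_le[OF Z_meas Z0 ZC]) auto
  qed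
  also have "\<dots> = (\<integral>\<omega>. \<phi> (Y N \<omega>) \<partial>M)"
  proof -
    have "(\<Sum>k<N. \<integral>\<omega>. Z k \<omega> \<partial>M) = (\<integral>\<omega>. (\<Sum>k<N. Z k \<omega>) \<partial>M)"
      using intZ by simp
    also have "(\<lambda>\<omega>. \<Sum>k<N. Z k \<omega>) = (\<lambda>\<omega>. \<phi> (Y N \<omega>) - \<phi> 0)"
    proof
      show "(\<Sum>k<N. Z k \<omega>) = \<phi> (Y N \<omega>) - \<phi> 0" for \<omega>
        using sum_lessThan_telescope[of "\<lambda>j. \<phi> (Y j \<omega>)" N] by (simp add: Z_def)
    qed
    also have "(\<integral>\<omega>. \<phi> (Y N \<omega>) - \<phi> 0 \<partial>M) = (\<integral>\<omega>. \<phi> (Y N \<omega>) \<partial>M) - \<phi> 0"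
      using integrable_comp_Y[OF \<phi>] by (simp add: prob_space)
    finally show ?thesis by simp
  qed
  finally show ?thesis by simp
qed

text \<open>Inserting \<open>dom\<close> bounds the expectation of \<open>f (Y N)\<close> by an
  affine function of itself. It is finite and \<open>\<kappa> < 1\<close>, so the inequality can be
  solved, with a bound free of \<open>N\<close>.\<close>

lemma expectation_le_closed:
  assumes f: "mono_on {0..} f" and \<phi>: "mono_on {0..} \<phi>" "0 \<le> \<phi> 0"
    and grad: "\<And>u v. 0 \<le> u \<Longrightarrow> u \<le> v \<Longrightarrow> f v - f u \<le> \<phi> v * (v - u)"
    and dom: "\<And>y. 0 \<le> y \<Longrightarrow> \<phi> y \<le> c + \<kappa> * f y" and "\<kappa> < 1"
  shows "(\<integral>\<omega>. f (Y N \<omega>) \<partial>M) \<le> (f 0 + c) / (1 - \<kappa>)"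
proof -
  have "(\<integral>\<omega>. \<phi> (Y N \<omega>) \<partial>M) \<le> (\<integral>\<omega>. c + \<kappa> * f (Y N \<omega>) \<partial>M)"
    by (rule integral_mono[OF integrable_comp_Y[OF \<phi>(1)] _ dom[OF Y_nonneg]])
       (simp add: integrable_comp_Y[OF f])
  also have "\<dots> = c + \<kappa> * (\<integral>\<omega>. f (Y N \<omega>) \<partial>M)"
    using integrable_comp_Y[OF f] by (simp add: prob_space)
  finally have "(\<integral>\<omega>. f (Y N \<omega>) \<partial>M) \<le> f 0 + c + \<kappa> * (\<integral>\<omega>. f (Y N \<omega>) \<partial>M)"
    using expectation_le_gradient[OF f \<phi> grad, of N] by simp
  then show ?thesis
    using \<open>\<kappa> < 1\<close> by (simp add: field_simps)
qed

end

section \<open>From single submartingales to \<open>c_n\<close> and \<open>c_lim\<close>\<close>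

lemma c_n_le:
  fixes T :: "'w itself"
  assumes f: "mono_on {0..} f"
    and bd: "\<And>M F X. G00_member (M :: 'w measure) F X \<Longrightarrow> (\<integral>\<omega>. f (G00_member.Y M F X n \<omega>) \<partial>M) \<le> b"
  shows "c_n T f n \<le> ereal b"
  unfolding c_n_def
proof (rule SUP_least, clarify)
  fix M F X assume "(M, F, X) \<in> (G00 :: ('w measure \<times> (nat \<Rightarrow> 'w measure) \<times> (nat \<Rightarrow> 'w \<Rightarrow> real)) set)"
  then interpret G00_member M F X by unfold_locales
  show "ereal (\<integral>\<omega>. f (max 0 (predictable_part M F X n \<omega>)) \<partial>M) \<le> ereal b"
    using bd[OF G00_member_axioms] by (simp add: expectation_predictable_part[OF f])
qed

lemma incseq_c_n:
  fixes T :: "'w itself"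
  assumes f: "mono_on {0..} f"
  shows "incseq (c_n T f)"
proof (rule incseq_SucI)
  fix n
  have "ereal (\<integral>\<omega>. f (max 0 (predictable_part M F X n \<omega>)) \<partial>M)
      \<le> ereal (\<integral>\<omega>. f (max 0 (predictable_part M F X (Suc n) \<omega>)) \<partial>M)"
    if "(M, F, X) \<in> G00" for M :: "'w measure" and F X
  proof -
    interpret G00_member M F X
      using that by unfold_locales
    have "(\<integral>\<omega>. f (Y n \<omega>) \<partial>M) \<le> (\<integral>\<omega>. f (Y (Suc n) \<omega>) \<partial>M)"
    proof (rule integral_mono)
      show "f (Y n \<omega>) \<le> f (Y (Suc n) \<omega>)" for \<omega>
        using Y_nonneg[of n \<omega>] drift_bounds(1)[of n \<omega>]
        by (intro mono_onD[OF f]) (auto simp: Y_Suc)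
    qed (rule integrable_comp_Y[OF f])+
    then show ?thesis
      by (simp add: expectation_predictable_part[OF f])
  qed
  then show "c_n T f n \<le> c_n T f (Suc n)"
    unfolding c_n_def by (intro SUP_mono bexI) (auto simp only: split: prod.split)
qed

lemma c_lim_eq_SUP:
  fixes T :: "'w itself"
  assumes "mono_on {0..} f"
  shows "convergent (c_n T f)" "c_lim T f = (SUP n. c_n T f n)"
proof -
  note lim = LIMSEQ_SUP[OF incseq_c_n[OF assms, of T]]
  show "convergent (c_n T f)"
    using lim by (rule convergentI)
  show "c_lim T f = (SUP n. c_n T f n)"
    unfolding c_lim_def using lim by (rule limI)
qed

lemma c_lim_le:
  fixes T :: "'w itself"
  assumes "mono_on {0..} f" "mono_on {0..} \<phi>" "0 \<le> \<phi> 0"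
    and "\<And>u v. 0 \<le> u \<Longrightarrow> u \<le> v \<Longrightarrow> f v - f u \<le> \<phi> v * (v - u)"
    and "\<And>y. 0 \<le> y \<Longrightarrow> \<phi> y \<le> c + \<kappa> * f y" "\<kappa> < 1"
  shows "c_lim T f \<le> ereal ((f 0 + c) / (1 - \<kappa>))"
  unfolding c_lim_eq_SUP[OF assms(1)]
  by (intro SUP_least c_n_le[OF assms(1)] G00_member.expectation_le_closed[OF _ assms])

section \<open>Upper bounds\<close>

lemma exp_gradient:
  fixes l u v :: real
  shows "exp (l * v) - exp (l * u) \<le> l * exp (l * v) * (v - u)"
proof -
  have "exp (l * v) * (1 + l * (u - v)) \<le> exp (l * v) * exp (l * (u - v))"
    by (intro mult_left_mono exp_ge_add_one_self) simp
  also have "\<dots> = exp (l * u)"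
    by (simp add: algebra_simps flip: exp_add)
  finally show ?thesis
    by (simp add: algebra_simps)
qed

lemma mono_on_exp: "0 < (l::real) \<Longrightarrow> mono_on A (\<lambda>x. exp (l * x))"
  by (intro mono_onI) simp

text \<open>Here \<open>\<phi> = l * f\<close>, so the domination is an equality with
  \<open>c = 0\<close> and \<open>\<kappa> = l\<close>.\<close>

lemma c_lim_exp_le:
  assumes "0 < l" "l < 1"
  shows "c_lim T (\<lambda>x. exp (l * x)) \<le> ereal (1 / (1 - l))"
proof -
  have "c_lim T (\<lambda>x. exp (l * x)) \<le> ereal ((exp (l * 0) + 0) / (1 - l))"
  proof (rule c_lim_le)
    show "mono_on {0..} (\<lambda>x. l * exp (l * x))"
      using assms by (intro mono_onI) simp
  qed (use assms in \<open>auto intro: exp_gradient mono_on_exp\<close>)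
  then show ?thesis by simp
qed

lemma powr_eq_mult:
  fixes v m :: real
  shows "0 \<le> v \<Longrightarrow> v powr m = v powr (m - 1) * v"
  using powr_add[of v "m - 1" 1] by simp

lemma powr_gradient:
  fixes m u v :: real
  assumes "1 \<le> m" "0 \<le> u" "0 \<le> v"
  shows "v powr m - u powr m \<le> m * v powr (m - 1) * (v - u)"
proof (cases "u = 0 \<or> v = 0")
  case True
  have "v powr m = v powr (m - 1) * v"
    using assms by (intro powr_eq_mult)
  then have "v powr m \<le> m * v powr (m - 1) * v"
    using assms mult_right_mono[of 1 m "v powr (m - 1) * v"] by simp
  with True show ?thesis by auto
next
  case False
  have "m * v powr (m - 1) * (u - v) \<le> u powr m - v powr m"
    using assms False
    by (intro convex_on_imp_above_tangent[OF powr_convex _ _ _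
          has_field_derivative_at_within[OF has_real_derivative_powr]]) (auto simp: interior_open)
  then show ?thesis by (simp add: algebra_simps)
qed

lemma c_lim_powr_le:
  fixes m :: real
  assumes m: "1 \<le> m"
  shows "c_lim T (\<lambda>x. x powr m) \<le> ereal (m powr m)"
proof -
  have "c_lim T (\<lambda>x. x powr m) \<le> ereal ((0 powr m + m powr m / m) / (1 - (m - 1) / m))"
  proof (rule c_lim_le)
    show "mono_on {0..} (\<lambda>x. x powr m)" "mono_on {0..} (\<lambda>x. m * x powr (m - 1))"
      using m by (auto intro!: mono_onI powr_mono2)
    show "v powr m - u powr m \<le> m * v powr (m - 1) * (v - u)" if "0 \<le> u" "u \<le> v" for u v
      using that m by (intro powr_gradient) auto
    show "m * y powr (m - 1) \<le> m powr m / m + (m - 1) / m * y powr m" if "0 \<le> y" for y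
    proof -
      define a b c where "a = y powr (m - 1)" and "b = m powr m" and "c = y powr m"
      have "c = a * y"
        unfolding a_def c_def using that by (rule powr_eq_mult)
      \<comment> \<open>The tangent with contact point \<open>y\<close>, evaluated at
        \<open>m\<close>. The choice of \<open>m\<close> is explained by its being the positive
        point where \<open>x powr m\<close> equals its own derivative; hence the bound
        \<open>m powr m\<close>.\<close>
      moreover have "c - b \<le> m * a * (y - m)"
        unfolding a_def b_def c_def using m that by (intro powr_gradient) auto
      ultimately have "m * (m * a) \<le> b + (m - 1) * c"
        by (simp add: algebra_simps)
      then have "m * a \<le> b / m + (m - 1) / m * c"
        using m by (simp add: field_simps)
      then show ?thesis
        by (simp only: a_def b_def c_def)
    qed
  qed (use m in auto)
  also have "1 - (m - 1) / m = 1 / m"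
    using m by (simp add: field_simps)
  also have "(0 powr m + m powr m / m) / (1 / m) = m powr m"
    using m by simp
  finally show ?thesis .
qed

section \<open>Convex functions with concave derivative\<close>

locale concave_slope =
  fixes f f' :: "real \<Rightarrow> real"
  assumes strict_mono: "strict_mono_on {0..} f"
    and convex: "convex_on {0..} f"
    and deriv: "\<And>x. 0 \<le> x \<Longrightarrow> (f has_real_derivative f' x) (at x within {0..})"
    and concave: "concave_on {0..} f'"
begin

lemma mono: "mono_on {0..} f"
  using strict_mono by (rule strict_mono_on_imp_mono_on)

lemma tangent: "0 < c \<Longrightarrow> 0 \<le> x \<Longrightarrow> f' c * (x - c) \<le> f x - f c"
  by (rule convex_on_imp_above_tangent[OF convex _ _ _ deriv]) auto

lemma deriv_pos:
  assumes "0 < c"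
  shows "0 < f' c"
proof -
  have "f (c / 2) < f c"
    using assms by (intro strict_mono_onD[OF strict_mono]) auto
  with tangent[of c "c / 2"] assms have "0 < f' c * (c / 2)"
    by (simp add: algebra_simps)
  then show ?thesis
    using assms by (simp add: zero_less_mult_iff)
qed

text \<open>\<open>tangent\<close> requires a positive point, so at \<open>0\<close> the derivative
  is handled as the limit of right difference quotients, which are nonnegative and, near
  \<open>0\<close>, at most \<open>f' v\<close>.\<close>

lemma deriv_0_bounds:
  shows "0 \<le> f' 0" and "0 < v \<Longrightarrow> f' 0 \<le> f' v"
proof -
  have lim: "((\<lambda>y. (f y - f 0) / y) \<longlongrightarrow> f' 0) (at_right 0)"
    using deriv[of 0] by (simp add: has_field_derivative_iff at_within_Ici_at_right)
  show "0 \<le> f' 0"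
  proof (rule tendsto_lowerbound[OF lim])
    show "\<forall>\<^sub>F y in at_right 0. 0 \<le> (f y - f 0) / y"
      using eventually_at_right_less[of "0::real"]
    proof eventually_elim
      case (elim y)
      then show ?case
        using mono_onD[OF mono, of 0 y] by simp
    qed
  qed simp
  show "f' 0 \<le> f' v" if v: "0 < v"
  proof (rule tendsto_upperbound[OF lim])
    show "\<forall>\<^sub>F y in at_right 0. (f y - f 0) / y \<le> f' v"
      using eventually_at_right_real[OF v]
    proof eventually_elim
      case (elim y)
      then have y: "0 < y" "y < v" by auto
      have "(f 0 - f y) / (0 - y) \<le> (f 0 - f v) / (0 - v)"
        using y by (intro convex_on_slope_le[OF convex]) auto
      then have "(f y - f 0) / y \<le> (f v - f 0) / v"
        by (simp add: diff_divide_distrib)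
      also have "\<dots> \<le> f' v"
        using tangent[of v 0] v by (simp add: field_simps)
      finally show ?case .
    qed
  qed simp
qed

lemma deriv_mono: "mono_on {0..} f'"
proof (rule mono_onI)
  fix u v :: real assume uv: "u \<in> {0..}" "u \<le> v"
  consider "u = v" | "u = 0" "0 < v" | "0 < u" "u < v"
    using uv by fastforce
  then show "f' u \<le> f' v"
  proof cases
    case 3
    \<comment> \<open>Adding the tangent inequalities at the two points cancels the values of
      \<open>f\<close>.\<close>
    with tangent[of u v] tangent[of v u] have "0 \<le> (f' v - f' u) * (v - u)"
      by (simp add: algebra_simps)
    with 3 show ?thesis
      by (simp add: zero_le_mult_iff)
  qed (auto intro: deriv_0_bounds)
qed

text \<open>The slope \<open>p\<close> is minus the infimum of the right-hand slopes at
  \<open>s\<close> of the convex function \<open>- f'\<close>.\<close>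

lemma supergradient:
  assumes "0 < s"
  obtains p where "\<And>y. 0 \<le> y \<Longrightarrow> f' y \<le> f' s + p * (y - s)"
proof
  show "f' y \<le> f' s + - Inf ((\<lambda>t. (- f' s - - f' t) / (s - t)) ` ({s<..} \<inter> {0..})) * (y - s)"
    if "0 \<le> y" for y
    using convex_le_Inf_differential[OF concave[unfolded concave_on_def], of s y] assms that
    by simp
qed

text \<open>
  The slope \<open>\<kappa>\<close> is a supergradient of \<open>f'\<close> at the root \<open>s\<close> divided by \<open>f' s\<close>. It is at most \<open>1/s\<close>
  as \<open>f' 0 \<ge> 0\<close>; comparing \<open>f s - f 0\<close> with the tangent bounds over the two halves of \<open>[0, s]\<close>
  excludes \<open>\<kappa> \<ge> 1\<close>.
\<close>

lemma contraction_at_root: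
  assumes s: "0 < s" "f s - f 0 = f' s"
  obtains \<kappa> where "\<kappa> < 1" "\<And>y. 0 \<le> y \<Longrightarrow> f' y \<le> f' s + \<kappa> * (f y - f s)"
proof -
  obtain p where p: "\<And>y. 0 \<le> y \<Longrightarrow> f' y \<le> f' s + p * (y - s)"
    using supergradient[OF s(1)] by blast
  define \<kappa> where "\<kappa> = p / f' s"
  have pos: "0 < f' s"
    using s by (intro deriv_pos)
  have p_eq: "p = \<kappa> * f' s"
    using pos by (simp add: \<kappa>_def)
  have "0 \<le> p"
    using p[of "s + 1"] mono_onD[OF deriv_mono, of s "s + 1"] s by simp
  then have "0 \<le> \<kappa>"
    using pos by (simp add: \<kappa>_def)
  show thesis
  proof
    show "f' y \<le> f' s + \<kappa> * (f y - f s)" if "0 \<le> y" for y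
    proof -
      have "\<kappa> * (f' s * (y - s)) \<le> \<kappa> * (f y - f s)"
        using that s \<open>0 \<le> \<kappa>\<close> by (intro mult_left_mono tangent)
      then show ?thesis
        using p[OF that] by (simp add: p_eq mult.assoc)
    qed
    show "\<kappa> < 1"
    proof (rule ccontr)
      assume "\<not> \<kappa> < 1"
      have "(\<kappa> * s) * f' s \<le> 1 * f' s"
        using p[of 0] deriv_0_bounds(1) by (simp add: p_eq algebra_simps)
      then have "\<kappa> * s \<le> 1"
        using pos by (rule mult_right_le_imp_le)
      moreover have "1 * s \<le> \<kappa> * s"
        using \<open>\<not> \<kappa> < 1\<close> s by (intro mult_right_mono) auto
      ultimately have "s \<le> 1" by simp
      \<comment> \<open>A single tangent on all of \<open>[0, s]\<close> would only give
        \<open>s \<ge> 1\<close>; the midpoint gains the strictly negative term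
        \<open>- p * s * s / 4\<close>.\<close>
      have "f' (s / 2) * (s / 2) \<le> (f' s - p * (s / 2)) * (s / 2)"
        using p[of "s / 2"] s by (intro mult_right_mono) auto
      then have "f' s \<le> f' s * s - p * s * s / 4"
        using tangent[of s "s / 2"] tangent[of "s / 2" 0] s by (simp add: algebra_simps)
      also have "\<dots> < f' s * s"
        using \<open>\<not> \<kappa> < 1\<close> pos s by (simp add: p_eq)
      also have "\<dots> \<le> f' s"
        using \<open>s \<le> 1\<close> pos by simp
      finally show False by simp
    qed
  qed
qed

lemma continuous_f: "continuous_on {0..} f"
  using deriv by (intro DERIV_continuous_on) auto

lemma continuous_deriv: "continuous_on {0<..} f'"
proof -
  have "continuous_on {0<..} (\<lambda>x. - f' x)"
    using concave unfolding concave_on_def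
    by (intro convex_on_continuous convex_on_subset[of "{0..}" _ "{0<..}"]) auto
  then show ?thesis
    using continuous_on_minus[of "{0<..}" "\<lambda>x. - f' x"] by simp
qed

text \<open>Intermediate values on \<open>[1/2, 4]\<close>. The tangent at \<open>1/2\<close> bounds
  \<open>f (1/2) - f 0\<close> by half of \<open>f' (1/2)\<close>; midpoint concavity gives
  \<open>f' 4 \<le> 2 * f' 2\<close>, which the tangent at \<open>2\<close> bounds by
  \<open>f 4 - f 2\<close>.\<close>

lemma root_exists: "\<exists>s>0. f s - f 0 = f' s"
proof -
  let ?h = "\<lambda>x. f x - f 0 - f' x"
  have "?h (1/2) \<le> 0"
    using tangent[of "1/2" 0] deriv_pos[of "1/2"] by simp
  moreover have "0 \<le> ?h 4"
  proof -
    have "f' 0 + f' 4 \<le> 2 * f' 2"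
      using convex_onD[OF concave[unfolded concave_on_def], of "1/2" 0 4] by simp
    moreover have "f' 2 * 2 \<le> f 4 - f 2"
      using tangent[of 2 4] by simp
    moreover have "f 0 \<le> f 2"
      by (simp add: mono_onD[OF mono])
    ultimately show ?thesis
      using deriv_0_bounds(1) by simp
  qed
  moreover have "continuous_on {1/2..4} ?h"
    by (intro continuous_intros continuous_on_subset[OF continuous_f]
        continuous_on_subset[OF continuous_deriv]) auto
  ultimately have "\<exists>x\<ge>1/2. x \<le> 4 \<and> ?h x = 0"
    by (intro IVT') auto
  then obtain x where "1/2 \<le> x" "?h x = 0" by blast
  then show ?thesis
    by (intro exI[of _ x]) auto
qed

lemma surj:
  assumes "f 0 \<le> B"
  shows "\<exists>s\<ge>0. f s = B"
proof -
  \<comment> \<open>The point where the tangent at \<open>1\<close> reaches level \<open>B\<close>,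
    kept at or above \<open>1\<close>.\<close>
  define x where "x = max 1 (1 + (B - f 1) / f' 1)"
  have "(B - f 1) / f' 1 \<le> x - 1"
    by (simp add: x_def)
  then have "B - f 1 \<le> f' 1 * (x - 1)"
    using deriv_pos[of 1] by (simp add: field_simps)
  also have "\<dots> \<le> f x - f 1"
    by (rule tangent) (auto simp: x_def)
  finally have "B \<le> f x" by simp
  moreover have "continuous_on {0..x} f"
    by (rule continuous_on_subset[OF continuous_f]) auto
  moreover have "0 \<le> x"
    by (simp add: x_def)
  ultimately show ?thesis
    using IVT'[of f 0 B x] assms by blast
qed

text \<open>The substitution \<open>B = f s\<close> removes the inverse; \<open>f 0 < B\<close>
  becomes \<open>s > 0\<close>.\<close>

lemma solves_B_equation_iff:
  "solves_B_equation f f' B \<longleftrightarrow> (\<exists>s>0. f s = B \<and> f s - f 0 = f' s)"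
proof
  assume B: "solves_B_equation f f' B"
  then obtain s where s: "0 \<le> s" "f s = B"
    using surj[of B] by (auto simp: solves_B_equation_def)
  moreover have "inv_into {0..} f B = s"
    using s by (intro inv_into_f_eq strict_mono_on_imp_inj_on[OF strict_mono]) auto
  moreover have "s \<noteq> 0"
    using s(2) B by (auto simp: solves_B_equation_def)
  ultimately show "\<exists>s>0. f s = B \<and> f s - f 0 = f' s"
    using B by (intro exI[of _ s]) (simp add: solves_B_equation_def)
next
  assume "\<exists>s>0. f s = B \<and> f s - f 0 = f' s"
  then obtain s where s: "0 < s" "f s = B" "f s - f 0 = f' s" by blast
  moreover have "inv_into {0..} f B = s"
    using s by (intro inv_into_f_eq strict_mono_on_imp_inj_on[OF strict_mono]) auto
  ultimately show "solves_B_equation f f' B"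
    using deriv_pos[of s] by (simp add: solves_B_equation_def)
qed

lemma ex1_B: "\<exists>!B. solves_B_equation f f' B"
proof (rule ex_ex1I)
  show "\<exists>B. solves_B_equation f f' B"
    using root_exists by (auto simp: solves_B_equation_iff)
next
  \<comment> \<open>Both roots satisfy \<open>f - f 0 = f'\<close>, so the contraction at
    \<open>s\<close> bounds \<open>f t - f s\<close> by \<open>\<kappa>\<close> times itself.
    Exchanging the roots gives equality.\<close>
  have le: "f t \<le> f s" if s: "0 < s" "f s - f 0 = f' s" and t: "0 < t" "f t - f 0 = f' t" for s t
  proof -
    obtain \<kappa> where "\<kappa> < 1" "\<And>y. 0 \<le> y \<Longrightarrow> f' y \<le> f' s + \<kappa> * (f y - f s)"
      using contraction_at_root[OF s] by blast
    moreover from this(2)[of t] have "f' t \<le> f' s + \<kappa> * (f t - f s)"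
      using t by simp
    then have "(1 - \<kappa>) * (f t - f s) \<le> 0"
      using s t by (simp add: algebra_simps)
    ultimately show ?thesis
      by (simp add: mult_le_0_iff)
  qed
  show "B = B'" if "solves_B_equation f f' B" "solves_B_equation f f' B'" for B B'
  proof -
    obtain s where "0 < s" "f s = B" "f s - f 0 = f' s"
      using \<open>solves_B_equation f f' B\<close> unfolding solves_B_equation_iff by blast
    moreover obtain t where "0 < t" "f t = B'" "f t - f 0 = f' t"
      using \<open>solves_B_equation f f' B'\<close> unfolding solves_B_equation_iff by blast
    ultimately show ?thesis
      using le[of s t] le[of t s] by simp
  qed
qed

lemma c_lim_le_B:
  assumes "solves_B_equation f f' B"
  shows "c_lim T f \<le> ereal B"
proof -
  obtain s where s: "0 < s" "f s = B" "f s - f 0 = f' s"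
    using assms by (auto simp: solves_B_equation_iff)
  obtain \<kappa> where \<kappa>: "\<kappa> < 1" "\<And>y. 0 \<le> y \<Longrightarrow> f' y \<le> f' s + \<kappa> * (f y - f s)"
    using contraction_at_root[OF s(1,3)] by blast
  have "c_lim T f \<le> ereal ((f 0 + (f' s - \<kappa> * f s)) / (1 - \<kappa>))"
  proof (rule c_lim_le[OF mono deriv_mono deriv_0_bounds(1) _ _ \<open>\<kappa> < 1\<close>])
    show "f v - f u \<le> f' v * (v - u)" if "0 \<le> u" "u \<le> v" for u v
    proof (cases "v = 0")
      case False
      with that tangent[of v u] show ?thesis
        by (simp add: algebra_simps)
    qed (use that in simp)
    show "f' y \<le> f' s - \<kappa> * f s + \<kappa> * f y" if "0 \<le> y" for y
      using \<kappa>(2)[OF that] by (simp add: algebra_simps)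
  qed
  \<comment> \<open>The root equation turns the numerator into
    \<open>(1 - \<kappa>) * f s\<close>.\<close>
  also have "(f 0 + (f' s - \<kappa> * f s)) / (1 - \<kappa>) = B"
    using s \<open>\<kappa> < 1\<close> by (simp add: field_simps)
  finally show ?thesis .
qed

end

section \<open>Lower bound for exponentials\<close>

text \<open>
  The extremal example: \<open>X\<close> waits at \<open>0\<close> and jumps to \<open>1\<close> after a geometrically distributed number
  of steps. Its compensator grows linearly with slope \<open>d\<close> until the jump, so that
  \<open>Y\<^sub>\<infinity>\<close> is asymptotically exponential as \<open>d \<rightarrow> 0\<close>. The geometric variable \<open>h\<close> lives on the given
  infinite type via an injection \<open>g\<close> of the naturals.
\<close>

locale geometric_jump =
  fixes g :: "nat \<Rightarrow> 'w" and d :: real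
  assumes inj_g: "inj g" and d: "0 < d" "d < 1"
begin

text \<open>A left inverse of \<open>g\<close>; its values off the range of \<open>g\<close> are
  irrelevant since \<open>P\<close> puts no mass there.\<close>

definition h :: "'w \<Rightarrow> nat" where
  "h = inv g"

definition P :: "'w pmf" where
  "P = map_pmf g (geometric_pmf d)"

text \<open>At time \<open>n\<close> it is known whether \<open>h < n\<close>, and then the value of
  \<open>h\<close>, but \<open>h = n\<close> is not yet told from \<open>h > n\<close>. So the jump
  of \<open>X\<close>, at time \<open>Suc h\<close>, is not predictable.\<close>

definition F :: "nat \<Rightarrow> 'w measure" where
  "F n = vimage_algebra UNIV (\<lambda>\<omega>. min (h \<omega>) n) (count_space UNIV)"

definition X :: "nat \<Rightarrow> 'w \<Rightarrow> real" where
  "X n \<omega> = of_bool (h \<omega> < n)"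

lemma h_g [simp]: "h (g k) = k"
  by (simp add: h_def inj_g)

lemma prob_h: "measure_pmf.prob P {\<omega>. Q (h \<omega>)} = measure_pmf.prob (geometric_pmf d) {k. Q k}"
  by (simp add: P_def vimage_def)

lemma prob_h_eq: "measure_pmf.prob P {\<omega>. h \<omega> = n} = (1 - d) ^ n * d"
  using prob_h[of "\<lambda>k. k = n"] d by (simp add: measure_pmf_single)

lemma prob_h_ge: "measure_pmf.prob P {\<omega>. n \<le> h \<omega>} = (1 - d) ^ n"
proof -
  have "measure_pmf.prob P {\<omega>. n \<le> h \<omega>} = measure_pmf.prob (geometric_pmf d) (UNIV - {..<n})"
    unfolding prob_h by (rule arg_cong[where f = "measure_pmf.prob _"]) auto
  also have "\<dots> = 1 - measure_pmf.prob (geometric_pmf d) {..<n}"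
    using measure_pmf.prob_compl[of "{..<n}" "geometric_pmf d"] by simp
  also have "\<dots> = 1 - d * (\<Sum>k<n. (1 - d) ^ k)"
    using d by (simp add: measure_measure_pmf_finite mult.commute flip: sum_distrib_left)
  also have "\<dots> = (1 - d) ^ n"
    using one_diff_power_eq[of "1 - d" n] by simp
  finally show ?thesis .
qed

lemma space_F [simp]: "space (F n) = UNIV"
  by (simp add: F_def)

lemma measurable_F: "(\<lambda>\<omega>. q (min (h \<omega>) n)) \<in> borel_measurable (F n)"
  for q :: "nat \<Rightarrow> real"
  unfolding F_def
  by (rule measurable_compose[OF measurable_vimage_algebra1]) auto

lemma sets_F: "A \<in> sets (F n) \<longleftrightarrow> (\<exists>S. A = {\<omega>. min (h \<omega>) n \<in> S})"
  unfolding F_def by (subst sets_vimage_algebra2) (auto simp: vimage_def)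

lemma X_measurable_F: "X n \<in> borel_measurable (F n)"
proof -
  have "X n = (\<lambda>\<omega>. of_bool (min (h \<omega>) n < n))"
    by (intro ext) (simp add: X_def min_less_iff_disj)
  then show ?thesis
    using measurable_F[of "\<lambda>k. of_bool (k < n)" n] by simp
qed

lemma integrable_bounded:
  fixes q :: "'w \<Rightarrow> real"
  shows "(\<And>\<omega>. \<bar>q \<omega>\<bar> \<le> C) \<Longrightarrow> integrable (measure_pmf P) q"
  by (intro measure_pmf.integrable_const_bound[of _ C]) auto

lemma integrable_X: "integrable (measure_pmf P) (X n)"
  by (rule integrable_bounded[of _ 1]) (simp add: X_def)

lemma subalgebra_F: "subalgebra (measure_pmf P) (F n)"
  by (simp add: subalgebra_def)

lemma sigma_finite_subalgebra_F: "sigma_finite_subalgebra (measure_pmf P) (F n)"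
  by (intro sigma_finite_subalgebra.intro subalgebra_F finite_measure_subalgebra_is_sigma_finite
      finite_measure_subalgebra.intro finite_measure_subalgebra_axioms.intro) unfold_locales

text \<open>A set in \<open>F n\<close> contains all or none of the points with
  \<open>n \<le> h\<close>. The increment is \<open>1\<close> exactly when \<open>h = n\<close>, an
  event with \<open>d\<close> times the probability of \<open>n \<le> h\<close>.\<close>

lemma drift:
  "AE \<omega> in measure_pmf P.
     real_cond_exp (measure_pmf P) (F n) (\<lambda>\<omega>. X (Suc n) \<omega> - X n \<omega>) \<omega> = d * of_bool (n \<le> h \<omega>)"
proof -
  interpret sigma_finite_subalgebra "measure_pmf P" "F n" by (rule sigma_finite_subalgebra_F)
  show ?thesis
  proof (rule real_cond_exp_charact)
    fix A assume "A \<in> sets (F n)"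
    then obtain S where S: "A = {\<omega>. min (h \<omega>) n \<in> S}"
      by (auto simp: sets_F)
    have "(\<integral>\<omega>\<in>A. X (Suc n) \<omega> - X n \<omega> \<partial>measure_pmf P)
        = (\<integral>\<omega>. of_bool (n \<in> S) * indicator {\<omega>. h \<omega> = n} \<omega> \<partial>measure_pmf P)"
      unfolding set_lebesgue_integral_def
      by (intro Bochner_Integration.integral_cong) (auto simp: S X_def indicator_def min_def)
    also have "\<dots> = (\<integral>\<omega>. (of_bool (n \<in> S) * d) * indicator {\<omega>. n \<le> h \<omega>} \<omega> \<partial>measure_pmf P)"
      by (simp add: prob_h_eq prob_h_ge)
    also have "\<dots> = (\<integral>\<omega>\<in>A. d * of_bool (n \<le> h \<omega>) \<partial>measure_pmf P)"
      unfolding set_lebesgue_integral_def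
      by (intro Bochner_Integration.integral_cong) (auto simp: S indicator_def min_def)
    finally show "(\<integral>\<omega>\<in>A. X (Suc n) \<omega> - X n \<omega> \<partial>measure_pmf P)
        = (\<integral>\<omega>\<in>A. d * of_bool (n \<le> h \<omega>) \<partial>measure_pmf P)" .
  next
    show "integrable (measure_pmf P) (\<lambda>\<omega>. X (Suc n) \<omega> - X n \<omega>)"
      by (intro Bochner_Integration.integrable_diff integrable_X)
    show "integrable (measure_pmf P) (\<lambda>\<omega>. d * of_bool (n \<le> h \<omega>))"
      using d by (intro integrable_bounded[of _ 1]) auto
    have "(\<lambda>\<omega>. d * of_bool (n \<le> h \<omega>)) = (\<lambda>\<omega>. d * of_bool (n \<le> min (h \<omega>) n))"
      by auto
    then show "(\<lambda>\<omega>. d * of_bool (n \<le> h \<omega>)) \<in> borel_measurable (F n)"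
      using measurable_F[of "\<lambda>k. d * of_bool (n \<le> k)" n] by simp
  qed
qed

lemma in_G00: "(measure_pmf P, F, X) \<in> G00"
proof -
  have "filtration UNIV F"
  proof
    show "sets (F i) \<subseteq> sets (F j)" if "i \<le> j" for i j
    proof
      fix A assume "A \<in> sets (F i)"
      then obtain S where "A = {\<omega>. min (h \<omega>) i \<in> S}"
        by (auto simp: sets_F)
      also have "\<dots> = {\<omega>. min (h \<omega>) j \<in> {k. min k i \<in> S}}"
        using that by (simp add: min.assoc min_absorb2)
      finally show "A \<in> sets (F j)"
        unfolding sets_F by blast
    qed
  qed simp
  moreover have "AE \<omega> in measure_pmf P. X n \<omega> \<le> real_cond_exp (measure_pmf P) (F n) (X (Suc n)) \<omega>"
    for n
  proof -
    interpret sigma_finite_subalgebra "measure_pmf P" "F n" by (rule sigma_finite_subalgebra_F)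
    have "AE \<omega> in measure_pmf P. real_cond_exp (measure_pmf P) (F n) (X n) \<omega> = X n \<omega>"
      by (intro real_cond_exp_F_meas integrable_X X_measurable_F)
    moreover have "AE \<omega> in measure_pmf P.
        real_cond_exp (measure_pmf P) (F n) (\<lambda>\<omega>. X (Suc n) \<omega> - X n \<omega>) \<omega>
        = real_cond_exp (measure_pmf P) (F n) (X (Suc n)) \<omega>
          - real_cond_exp (measure_pmf P) (F n) (X n) \<omega>"
      by (intro real_cond_exp_diff integrable_X)
    ultimately show ?thesis
      using drift[of n]
    proof eventually_elim
      case (elim \<omega>)
      then have "real_cond_exp (measure_pmf P) (F n) (X (Suc n)) \<omega> - X n \<omega> = d * of_bool (n \<le> h \<omega>)"
        by simp
      moreover have "0 \<le> d * of_bool (n \<le> h \<omega>)"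
        using d by simp
      ultimately show ?case by linarith
    qed
  qed
  ultimately show ?thesis
    by (auto simp: G00_def filtered_prob_space_def submartingale_def X_measurable_F integrable_X
        subalgebra_F prob_space_measure_pmf X_def)
qed

lemma predictable_part_eq:
  "AE \<omega> in measure_pmf P. predictable_part (measure_pmf P) F X n \<omega> = d * min n (Suc (h \<omega>))"
proof -
  have "AE \<omega> in measure_pmf P. \<forall>k. real_cond_exp (measure_pmf P) (F k) (\<lambda>\<omega>. X (Suc k) \<omega> - X k \<omega>) \<omega>
      = d * of_bool (k \<le> h \<omega>)"
    unfolding AE_all_countable using drift by blast
  then show ?thesis
  proof eventually_elim
    case (elim \<omega>)
    have "predictable_part (measure_pmf P) F X n \<omega> = (\<Sum>k = 1..n. d * of_bool (k - 1 \<le> h \<omega>))"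
      unfolding predictable_part_def
    proof (intro sum.cong refl)
      fix k assume "k \<in> {1..n}"
      then show "real_cond_exp (measure_pmf P) (F (k - 1)) (\<lambda>\<omega>'. X k \<omega>' - X (k - 1) \<omega>') \<omega>
          = d * of_bool (k - 1 \<le> h \<omega>)"
        using elim[rule_format, of "k - 1"] by simp
    qed
    \<comment> \<open>The drift acts at times \<open>0\<close> to \<open>h\<close>, hence
      \<open>Suc h\<close> times if not cut off by \<open>n\<close>.\<close>
    also have "\<dots> = d * min n (Suc (h \<omega>))"
      by (induction n) (auto simp: min_def algebra_simps le_Suc_eq)
    finally show ?case .
  qed
qed

text \<open>Only outcomes with \<open>h < n\<close> are kept, where the predictable part is
  \<open>d * Suc h\<close>; the others contribute nonnegatively.\<close>

lemma c_n_ge: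
  fixes T :: "'w itself" and f :: "real \<Rightarrow> real"
  assumes f: "mono_on {0..} f" "0 \<le> f 0"
  shows "ereal (\<Sum>k<n. (1 - d) ^ k * d * f (d * Suc k)) \<le> c_n T f n"
proof -
  have f_nonneg: "0 \<le> f x" if "0 \<le> x" for x
    using mono_onD[OF f(1), of 0 x] f(2) that by simp
  define q where "q k = f (d * min n (Suc k))" for k
  have q: "0 \<le> q k" "q k \<le> f (d * n)" for k
    unfolding q_def using d by (auto intro!: f_nonneg mono_onD[OF f(1)])
  have "(\<Sum>k<n. (1 - d) ^ k * d * f (d * Suc k))
      = (\<Sum>k<n. q k * indicator {..<n} k * pmf (geometric_pmf d) k)"
    using d by (intro sum.cong) (auto simp: q_def min_absorb2)
  also have "\<dots> = (\<integral>k. q k * indicator {..<n} k \<partial>measure_pmf (geometric_pmf d))"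
    by (intro integral_measure_pmf_real[symmetric]) (auto split: split_indicator_asm)
  also have "\<dots> \<le> (\<integral>k. q k \<partial>measure_pmf (geometric_pmf d))"
    using q by (intro integral_mono measure_pmf.integrable_const_bound[of _ "f (d * n)"])
      (auto split: split_indicator intro: order_trans[of 0 "q 0"])
  also have "\<dots> = (\<integral>\<omega>. q (h \<omega>) \<partial>measure_pmf P)"
    by (simp add: P_def)
  also have "\<dots> = (\<integral>\<omega>. f (max 0 (predictable_part (measure_pmf P) F X n \<omega>)) \<partial>measure_pmf P)"
  proof (rule integral_cong_AE)
    show "AE \<omega> in measure_pmf P.
        q (h \<omega>) = f (max 0 (predictable_part (measure_pmf P) F X n \<omega>))"
      using predictable_part_eq[of n]
    proof eventually_elim
      case (elim \<omega>)
      then show ?case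
        using d by (simp add: q_def max_absorb2)
    qed
  qed simp_all
  finally show ?thesis
    unfolding c_n_def using in_G00 by (intro SUP_upper2[of "(measure_pmf P, F, X)"]) auto
qed

end

section \<open>Small jump probabilities\<close>

text \<open>The exponent \<open>l'\<close> may exceed \<open>1\<close> while \<open>l\<close> does
  not, so one estimate serves both cases of (a).\<close>

lemma c_lim_exp_ge:
  fixes T :: "'w itself"
  assumes inf: "infinite (UNIV :: 'w set)" and d: "0 < d" "d < 1" and l: "0 < l" "l \<le> 1" "l \<le> l'"
  shows "ereal (1 / (1 - l + l * d)) \<le> c_lim T (\<lambda>x. exp (l' * x))"
proof -
  obtain g :: "nat \<Rightarrow> 'w" where "inj g"
    using infinite_countable_subset[OF inf] by blast
  then interpret geometric_jump g d
    using d by unfold_locales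
  have mono: "mono_on {0..} (\<lambda>x::real. exp (l' * x))"
    using l by (intro mono_onI) simp
  \<comment> \<open>The bound \<open>1 + l * d \<le> exp (l' * d)\<close> leads to a geometric
    series with ratio \<open>r\<close>; the summand \<open>l * d\<close> in
    \<open>1 - l + l * d\<close> keeps \<open>r < 1\<close> even at \<open>l = 1\<close>.\<close>
  define r where "r = (1 - d) * (1 + l * d)"
  have "1 - r = d * (1 - l + l * d)"
    by (simp add: r_def algebra_simps)
  moreover have pos: "0 < 1 - l + l * d"
    using l d by (intro add_nonneg_pos) auto
  ultimately have "r < 1"
    using d by (smt (verit) mult_pos_pos)
  have "0 \<le> r"
    using l d by (simp add: r_def)
  have le: "ereal (d * (1 + l * d) * (\<Sum>k<n. r ^ k)) \<le> c_lim T (\<lambda>x. exp (l' * x))" for n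
  proof -
    have "d * (1 + l * d) * (\<Sum>k<n. r ^ k) = (\<Sum>k<n. (1 - d) ^ k * d * (1 + l * d) ^ Suc k)"
      by (simp add: sum_distrib_left r_def power_mult_distrib ac_simps)
    also have "\<dots> \<le> (\<Sum>k<n. (1 - d) ^ k * d * exp (l' * (d * Suc k)))"
    proof (intro sum_mono mult_left_mono)
      fix k
      have "1 + l * d \<le> exp (l * d)"
        by (rule exp_ge_add_one_self)
      also have "\<dots> \<le> exp (l' * d)"
        using l d by simp
      finally have "(1 + l * d) ^ Suc k \<le> exp (l' * d) ^ Suc k"
        using l d by (intro power_mono) auto
      then show "(1 + l * d) ^ Suc k \<le> exp (l' * (d * Suc k))"
        by (simp only: exp_of_nat_mult[symmetric] ac_simps)
    qed (use d in auto)
    finally have "ereal (d * (1 + l * d) * (\<Sum>k<n. r ^ k))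
        \<le> ereal (\<Sum>k<n. (1 - d) ^ k * d * exp (l' * (d * Suc k)))"
      by simp
    also have "\<dots> \<le> c_n T (\<lambda>x. exp (l' * x)) n"
      by (rule c_n_ge[OF mono]) simp
    also have "\<dots> \<le> c_lim T (\<lambda>x. exp (l' * x))"
      unfolding c_lim_eq_SUP(2)[OF mono] by (rule SUP_upper) simp
    finally show ?thesis .
  qed
  have "(\<lambda>n. \<Sum>k<n. r ^ k) \<longlonglongrightarrow> 1 / (1 - r)"
    using geometric_sums[of r] \<open>0 \<le> r\<close> \<open>r < 1\<close> by (simp add: sums_def)
  then have "(\<lambda>n. ereal (d * (1 + l * d) * (\<Sum>k<n. r ^ k)))
      \<longlonglongrightarrow> ereal (d * (1 + l * d) * (1 / (1 - r)))"
    by (intro tendsto_intros)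
  then have "ereal (d * (1 + l * d) * (1 / (1 - r))) \<le> c_lim T (\<lambda>x. exp (l' * x))"
    by (rule LIMSEQ_le_const2) (use le in blast)
  moreover have "1 / (1 - l + l * d) \<le> d * (1 + l * d) * (1 / (1 - r))"
  proof -
    have "1 / (1 - l + l * d) \<le> (1 + l * d) / (1 - l + l * d)"
      using pos l d by (intro divide_right_mono) auto
    then show ?thesis
      unfolding \<open>1 - r = _\<close> using d by simp
  qed
  ultimately show ?thesis
    by (meson ereal_less_eq(3) order_trans)
qed

lemma c_lim_exp_ge_inverse:
  fixes T :: "'w itself"
  assumes inf: "infinite (UNIV :: 'w set)" and l: "0 < l" "l < 1"
  shows "ereal (1 / (1 - l)) \<le> c_lim T (\<lambda>x. exp (l * x))"
proof (rule tendsto_upperbound)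
  have "((\<lambda>d. 1 / (1 - l + l * d)) \<longlongrightarrow> 1 / (1 - l + l * 0)) (at_right 0)"
    using l by (intro tendsto_intros) auto
  then show "((\<lambda>d. ereal (1 / (1 - l + l * d))) \<longlongrightarrow> ereal (1 / (1 - l))) (at_right 0)"
    by simp
  show "\<forall>\<^sub>F d in at_right 0. ereal (1 / (1 - l + l * d)) \<le> c_lim T (\<lambda>x. exp (l * x))"
    using eventually_at_right_real[of 0 "1::real", OF zero_less_one]
    by eventually_elim (use l in \<open>auto intro!: c_lim_exp_ge[OF inf]\<close>)
qed simp

lemma c_lim_exp_eq_top:
  fixes T :: "'w itself"
  assumes inf: "infinite (UNIV :: 'w set)" and l: "1 \<le> l"
  shows "c_lim T (\<lambda>x. exp (l * x)) = \<infinity>"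
proof (rule ereal_top)
  fix B :: real
  \<comment> \<open>Parameter \<open>1\<close> below the exponent, with
    \<open>d = 1 / max B 2\<close>: the value is \<open>max B 2\<close>, and the \<open>2\<close>
    keeps \<open>d < 1\<close>.\<close>
  have "ereal B \<le> ereal (1 / (1 - 1 + 1 * (1 / max B 2)))"
    by simp
  also have "\<dots> \<le> c_lim T (\<lambda>x. exp (l * x))"
    by (rule c_lim_exp_ge[OF inf]) (use l in auto)
  finally show "ereal B \<le> c_lim T (\<lambda>x. exp (l * x))" .
qed

text \<open>The convergence clause certifies that the \<open>lim\<close> in \<open>c_lim\<close> is
  a genuine limit. An infinite type leaves room for the geometric variable of the extremal
  example.\<close>

theorem theorem1:
  fixes T :: "'w itself"
  assumes "infinite (UNIV :: 'w set)"
  shows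
    "(\<forall>f. mono_on {0..} f \<longrightarrow> convergent (c_n T f)) \<and>
     (\<forall>l::real. (0 < l \<and> l < 1 \<longrightarrow> c_lim T (\<lambda>x. exp (l * x)) = ereal (1 / (1 - l))) \<and>
                (1 \<le> l \<longrightarrow> c_lim T (\<lambda>x. exp (l * x)) = \<infinity>)) \<and>
     (\<forall>m::real. 1 \<le> m \<longrightarrow> c_lim T (\<lambda>x. x powr m) \<le> ereal (m powr m)) \<and>
     (\<forall>f f'. strict_mono_on {0..} f \<and> convex_on {0..} f \<and>
             (\<forall>x\<ge>0. (f has_real_derivative f' x) (at x within {0..})) \<and>
             concave_on {0..} f' \<longrightarrow>
        (\<exists>!B. solves_B_equation f f' B) \<and>
        (\<forall>B. solves_B_equation f f' B \<longrightarrow> c_lim T f \<le> ereal B))"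
proof (intro conjI allI impI)
  show "convergent (c_n T f)" if "mono_on {0..} f" for f
    using that by (rule c_lim_eq_SUP)
next
  fix l :: real assume "0 < l \<and> l < 1"
  then show "c_lim T (\<lambda>x. exp (l * x)) = ereal (1 / (1 - l))"
    by (intro antisym c_lim_exp_le c_lim_exp_ge_inverse assms) auto
next
  show "c_lim T (\<lambda>x. exp (l * x)) = \<infinity>" if "1 \<le> l" for l :: real
    using assms that by (rule c_lim_exp_eq_top)
next
  show "c_lim T (\<lambda>x. x powr m) \<le> ereal (m powr m)" if "1 \<le> m" for m :: real
    using that by (rule c_lim_powr_le)
next
  fix f f' :: "real \<Rightarrow> real"
  assume "strict_mono_on {0..} f \<and> convex_on {0..} f \<and>
    (\<forall>x\<ge>0. (f has_real_derivative f' x) (at x within {0..})) \<and> concave_on {0..} f'"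
  then interpret concave_slope f f'
    by unfold_locales auto
  show "\<exists>!B. solves_B_equation f f' B"
    by (rule ex1_B)
  show "c_lim T f \<le> ereal B" if "solves_B_equation f f' B" for B
    using that by (rule c_lim_le_B)
qed

end
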